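(* Let $A\subset\mathbb{R}^m$ be finite, $r\in\mathbb{R}^m$, and let $[a,b]=\prod_{j=1}^m[a_j,b_j]$ with $a_j<b_j$ be a fixed truncation box. For $\mu\in\mathbb{R}^m$, $\sigma\in(0,\infty)^m$ let $\mathrm{TEHVI}_A(\mu,\sigma;a,b)$ be the truncated expected hypervolume improvement for independent coordinates. Then: (1) (PHVI-type representation) let $Y_j$ have the $N(\mu_j,\sigma_j^2)$ law conditioned on $[a_j,b_j]$ and put $\psi_j(c)=\mathbb{E}[(c-Y_j)_+]$, $\psi(c)=(\psi_1(c_1),\dots,\psi_m(c_m))$. Then $$\mathrm{TEHVI}_A(\mu,\sigma;a,b)=\mathrm{HV}_{\psi(r)}\bigl(\psi(A)\cup\{0\}\bigr)-\mathrm{HV}_{\psi(r)}\bigl(\psi(A)\bigr).$$ (2) (mean monotonicity) if $\mu_j'\le\mu_j$ for all $j$, then $\mathrm{TEHVI}_A(\mu',\sigma;a,b)\ge\mathrm{TEHVI}_A(\mu,\sigma;a,b)$. (3) (failure of variance monotonicity) variance monotonicity can fail for fixed-box truncation: there exist $m\ge 2$, a finite set $A$, $r$, $a,b,\mu\in\mathbb{R}^m$ with $a_j<b_j$ for all $j$, and $\sigma,\sigma'\in(0,\infty)^m$ with $\sigma'_j\ge\sigma_j$ for all $j$ such that $\mathrm{TEHVI}_A(\mu,\sigma';a,b)<\mathrm{TEHVI}_A(\mu,\sigma;a,b)$.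
   Context: Minimization convention. $\mathrm{Dom}_r(A)=\bigcup_{a\in A}[a_1,r_1]\times\cdots\times[a_m,r_m]$ (a box being empty if its lower corner exceeds $r$ in some coordinate), $\mathrm{HV}_r(A)=\int_{\mathrm{Dom}_r(A)}1\,dy$, and $I_A(y)=\mathrm{HV}_r(A\cup\{y\})-\mathrm{HV}_r(A)$. Let $p^{[a,b]}_{\mu,\sigma}$ be the density of a vector $Y$ with independent coordinates $N(\mu_j,\sigma_j^2)$ conditioned on $Y\in[a,b]$ (a product of one-dimensional truncated Gaussian densities). Then $\mathrm{TEHVI}_A(\mu,\sigma;a,b)=\int_{[a,b]}I_A(y)\,p^{[a,b]}_{\mu,\sigma}(y)\,dy$. Notation: $(u)_+=\max\{u,0\}$ and $\psi(A)=\{\psi(y):y\in A\}$. *)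

theory Defs
  imports "HOL-Probability.Probability"
begin

text \<open>
  The dimension \<open>m\<close> is quantified inside the statement (in the last part existentially), so
  vectors of length \<open>m\<close> are functions on the index set \<open>{..<m}\<close>, extensional outside it;
  the coordinates \<open>1, \<dots>, m\<close> become \<open>0, \<dots>, m - 1\<close>.
\<close>

definition Rvec :: "nat \<Rightarrow> (nat \<Rightarrow> real) set"
  where "Rvec m = ({..<m} \<rightarrow>\<^sub>E UNIV)"

definition leb :: "nat \<Rightarrow> (nat \<Rightarrow> real) measure"
  where "leb m = (\<Pi>\<^sub>M j\<in>{..<m}. lborel)"

definition box_vec :: "nat \<Rightarrow> (nat \<Rightarrow> real) \<Rightarrow> (nat \<Rightarrow> real) \<Rightarrow> (nat \<Rightarrow> real) set"
  where "box_vec m a b = (\<Pi>\<^sub>E j\<in>{..<m}. {a j..b j})"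

definition Dom :: "nat \<Rightarrow> (nat \<Rightarrow> real) \<Rightarrow> (nat \<Rightarrow> real) set \<Rightarrow> (nat \<Rightarrow> real) set"
  where "Dom m r A = (\<Union>a\<in>A. box_vec m a r)"

definition HV :: "nat \<Rightarrow> (nat \<Rightarrow> real) \<Rightarrow> (nat \<Rightarrow> real) set \<Rightarrow> real"
  where "HV m r A = (LINT y:Dom m r A|leb m. 1)"

definition HVI :: "nat \<Rightarrow> (nat \<Rightarrow> real) \<Rightarrow> (nat \<Rightarrow> real) set \<Rightarrow> (nat \<Rightarrow> real) \<Rightarrow> real"
  where "HVI m r A y = HV m r (A \<union> {y}) - HV m r A"

text \<open>The law of a normal variable (standard deviation \<open>s\<close>) conditioned on \<open>{l..u}\<close>.\<close>

definition normal_law :: "real \<Rightarrow> real \<Rightarrow> real measure"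
  where "normal_law \<mu> s = density lborel (\<lambda>x. ennreal (normal_density \<mu> s x))"

definition trunc_normal_law :: "real \<Rightarrow> real \<Rightarrow> real \<Rightarrow> real \<Rightarrow> real measure"
  where "trunc_normal_law l u \<mu> s = uniform_measure (normal_law \<mu> s) {l..u}"

definition trunc_normal_density :: "real \<Rightarrow> real \<Rightarrow> real \<Rightarrow> real \<Rightarrow> real \<Rightarrow> real"
  where "trunc_normal_density l u \<mu> s x =
    indicator {l..u} x * normal_density \<mu> s x / (LINT t:{l..u}|lborel. normal_density \<mu> s t)"

text \<open>
  The product of the truncated densities. By \<open>density_trunc_density_vec\<close> below, this is the
  density of a vector of independent normal coordinates conditioned on the box.
\<close>

definition trunc_density_vec ::
    "nat \<Rightarrow> (nat \<Rightarrow> real) \<Rightarrow> (nat \<Rightarrow> real) \<Rightarrow> (nat \<Rightarrow> real) \<Rightarrow> (nat \<Rightarrow> real) \<Rightarrow> (nat \<Rightarrow> real) \<Rightarrow> real"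
  where "trunc_density_vec m a b \<mu> \<sigma> y =
    (\<Prod>j<m. trunc_normal_density (a j) (b j) (\<mu> j) (\<sigma> j) (y j))"

definition TEHVI ::
    "nat \<Rightarrow> (nat \<Rightarrow> real) \<Rightarrow> (nat \<Rightarrow> real) set \<Rightarrow> (nat \<Rightarrow> real) \<Rightarrow> (nat \<Rightarrow> real) \<Rightarrow>
     (nat \<Rightarrow> real) \<Rightarrow> (nat \<Rightarrow> real) \<Rightarrow> real"
  where "TEHVI m r A \<mu> \<sigma> a b =
    (LINT y:box_vec m a b|leb m. HVI m r A y * trunc_density_vec m a b \<mu> \<sigma> y)"

definition psi1 :: "real \<Rightarrow> real \<Rightarrow> real \<Rightarrow> real \<Rightarrow> real \<Rightarrow> real"
  where "psi1 l u \<mu> s c = (LINT y|trunc_normal_law l u \<mu> s. max (c - y) 0)"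

definition psi ::
    "nat \<Rightarrow> (nat \<Rightarrow> real) \<Rightarrow> (nat \<Rightarrow> real) \<Rightarrow> (nat \<Rightarrow> real) \<Rightarrow> (nat \<Rightarrow> real) \<Rightarrow>
     (nat \<Rightarrow> real) \<Rightarrow> (nat \<Rightarrow> real)"
  where "psi m a b \<mu> \<sigma> c = (\<lambda>j\<in>{..<m}. psi1 (a j) (b j) (\<mu> j) (\<sigma> j) (c j))"

definition zero_vec :: "nat \<Rightarrow> (nat \<Rightarrow> real)"
  where "zero_vec m = (\<lambda>j\<in>{..<m}. 0)"

lemma emeasure_normal_law_Icc:
  assumes "0 < s"
  shows "emeasure (normal_law \<mu> s) {l..u} =
    ennreal (LINT t:{l..u}|lborel. normal_density \<mu> s t)"
proof -
  have i: "set_integrable lborel {l..u} (normal_density \<mu> s)"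
    using integrable_mult_indicator[OF _ integrable_normal_density[OF assms, of \<mu>], of "{l..u}"]
    by (simp add: set_integrable_def)
  have "emeasure (normal_law \<mu> s) {l..u} =
      (\<integral>\<^sup>+x. ennreal (indicator {l..u} x *\<^sub>R normal_density \<mu> s x) \<partial>lborel)"
    unfolding normal_law_def
    by (subst emeasure_density) (auto intro!: nn_integral_cong simp: indicator_def)
  also have "\<dots> = ennreal (LINT t:{l..u}|lborel. normal_density \<mu> s t)"
    unfolding set_lebesgue_integral_def
    by (rule nn_integral_eq_integral)
      (use i in \<open>auto simp: set_integrable_def indicator_def\<close>)
  finally show ?thesis .
qed

lemma normal_mass_pos:
  assumes "0 < s" "l < u"
  shows "0 < (LINT t:{l..u}|lborel. normal_density \<mu> s t)"
proof -
  have "emeasure (normal_law \<mu> s) {l..u} \<noteq> 0"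
  proof
    assume z: "emeasure (normal_law \<mu> s) {l..u} = 0"
    have "{l..u} \<in> null_sets (normal_law \<mu> s)"
      using z by (auto simp: null_sets_def normal_law_def)
    then have "AE x in lborel. x \<in> {l..u} \<longrightarrow> ennreal (normal_density \<mu> s x) = 0"
      unfolding normal_law_def by (subst (asm) null_sets_density_iff) auto
    then have "AE x in lborel. x \<notin> {l..u}"
      by eventually_elim (simp add: normal_density_pos[OF assms(1), THEN less_imp_neq, symmetric])
    then have "emeasure lborel {l..u} = 0"
      by (subst (asm) AE_iff_measurable[where N = "{l..u}"]) auto
    with assms(2) show False by simp
  qed
  then show ?thesis
    unfolding emeasure_normal_law_Icc[OF assms(1)] by (simp add: ennreal_eq_0_iff)
qed

lemma density_trunc_normal_density:
  assumes "0 < s" "l < u"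
  shows "density lborel (\<lambda>x. ennreal (trunc_normal_density l u \<mu> s x)) = trunc_normal_law l u \<mu> s"
proof -
  let ?Z = "LINT t:{l..u}|lborel. normal_density \<mu> s t"
  have Z: "0 < ?Z" by (rule normal_mass_pos[OF assms])
  have "trunc_normal_law l u \<mu> s =
      density lborel (\<lambda>x. ennreal (normal_density \<mu> s x) * (indicator {l..u} x / ennreal ?Z))"
    unfolding trunc_normal_law_def uniform_measure_def emeasure_normal_law_Icc[OF assms(1)]
    unfolding normal_law_def by (subst density_density_eq) auto
  also have "\<dots> = density lborel (\<lambda>x. ennreal (trunc_normal_density l u \<mu> s x))"
  proof (rule density_cong)
    show "AE x in lborel. ennreal (normal_density \<mu> s x) * (indicator {l..u} x / ennreal ?Z) =
        ennreal (trunc_normal_density l u \<mu> s x)"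
    proof (rule AE_I2)
      fix x :: real
      show "ennreal (normal_density \<mu> s x) * (indicator {l..u} x / ennreal ?Z) =
          ennreal (trunc_normal_density l u \<mu> s x)"
        using Z unfolding trunc_normal_density_def
        by (cases "x \<in> {l..u}") (auto simp: divide_ennreal[symmetric] ennreal_times_divide)
    qed
  qed (auto simp: trunc_normal_density_def)
  finally show ?thesis by simp
qed

lemma prob_space_normal_law:
  assumes "0 < s"
  shows "prob_space (normal_law \<mu> s)"
  unfolding normal_law_def by (rule prob_space_normal_density[OF assms])

lemma prob_space_trunc_normal_law:
  assumes "0 < s" "l < u"
  shows "prob_space (trunc_normal_law l u \<mu> s)"
  unfolding trunc_normal_law_def
  using normal_mass_pos[OF assms, of \<mu>] emeasure_normal_law_Icc[OF assms(1), of \<mu> l u]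
  by (intro prob_space_uniform_measure) auto

lemma density_trunc_density_vec:
  assumes "\<And>j. j < m \<Longrightarrow> a j < b j" and "\<And>j. j < m \<Longrightarrow> 0 < \<sigma> j"
  shows "density (leb m) (\<lambda>y. ennreal (trunc_density_vec m a b \<mu> \<sigma> y)) =
    uniform_measure (\<Pi>\<^sub>M j\<in>{..<m}. normal_law (\<mu> j) (\<sigma> j)) (box_vec m a b)"
proof -
  define T where "T j = (if j < m then trunc_normal_law (a j) (b j) (\<mu> j) (\<sigma> j) else lborel)" for j
  define N where "N j = (if j < m then normal_law (\<mu> j) (\<sigma> j) else lborel)" for j
  let ?d = "\<lambda>j. trunc_normal_density (a j) (b j) (\<mu> j) (\<sigma> j)"
  have setsT: "sets (T j) = sets borel" for j
    by (simp add: T_def trunc_normal_law_def normal_law_def)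
  have setsN: "sets (N j) = sets borel" for j
    by (simp add: N_def normal_law_def)
  have T: "product_sigma_finite T"
  proof (rule product_sigma_finite.intro)
    fix j show "sigma_finite_measure (T j)"
      using prob_space_trunc_normal_law[OF assms(2,1), of j j "\<mu> j"] sigma_finite_lborel
      by (auto simp: T_def prob_space_imp_sigma_finite)
  qed
  have N: "product_sigma_finite N"
  proof (rule product_sigma_finite.intro)
    fix j show "sigma_finite_measure (N j)"
      using prob_space_normal_law[OF assms(2), of j "\<mu> j"] sigma_finite_lborel
      by (auto simp: N_def prob_space_imp_sigma_finite)
  qed
  have L: "product_sigma_finite (\<lambda>j::nat. lborel :: real measure)"
    by standard
  have d0: "0 \<le> ?d j x" if "j < m" for j x
    using normal_mass_pos[OF assms(2,1)[OF that], of "\<mu> j"]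
    by (auto simp: trunc_normal_density_def)
  have dmeas[measurable]: "?d j \<in> borel_measurable borel" for j
    unfolding trunc_normal_density_def by measurable
  have vmeas: "(\<lambda>y. ennreal (trunc_density_vec m a b \<mu> \<sigma> y)) \<in> borel_measurable (leb m)"
    unfolding trunc_density_vec_def leb_def by measurable
  have PN: "(\<Pi>\<^sub>M j\<in>{..<m}. normal_law (\<mu> j) (\<sigma> j)) = PiM {..<m} N"
    by (rule PiM_cong) (auto simp: N_def)
  have box: "box_vec m a b \<in> sets (PiM {..<m} N)"
    unfolding box_vec_def by (rule sets_PiM_I_finite) (auto simp: setsN)
  have setsNT: "sets (PiM {..<m} N) = sets (PiM {..<m} T)"
    by (rule sets_PiM_cong) (auto simp: setsN setsT)
  have 1: "density (leb m) (\<lambda>y. ennreal (trunc_density_vec m a b \<mu> \<sigma> y)) = PiM {..<m} T"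
  proof (rule product_sigma_finite.PiM_eqI[OF T])
    show "sets (density (leb m) (\<lambda>y. ennreal (trunc_density_vec m a b \<mu> \<sigma> y))) = sets (PiM {..<m} T)"
      unfolding leb_def sets_density by (rule sets_PiM_cong) (auto simp: setsT)
  next
    fix A assume A: "\<And>j. j \<in> {..<m} \<Longrightarrow> A j \<in> sets (T j)"
    have A': "A j \<in> sets borel" if "j < m" for j using A[of j] that by (simp add: setsT)
    have AL: "Pi\<^sub>E {..<m} A \<in> sets (leb m)"
      unfolding leb_def by (rule sets_PiM_I_finite) (use A' in auto)
    have "emeasure (density (leb m) (\<lambda>y. ennreal (trunc_density_vec m a b \<mu> \<sigma> y))) (Pi\<^sub>E {..<m} A) =
        (\<integral>\<^sup>+y. ennreal (trunc_density_vec m a b \<mu> \<sigma> y) * indicator (Pi\<^sub>E {..<m} A) y \<partial>leb m)"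
      by (rule emeasure_density[OF vmeas AL])
    also have "\<dots> = (\<integral>\<^sup>+y. (\<Prod>j<m. ennreal (?d j (y j)) * indicator (A j) (y j)) \<partial>leb m)"
    proof (rule nn_integral_cong)
      fix y assume "y \<in> space (leb m)"
      then have y: "y \<in> extensional {..<m}"
        by (simp add: leb_def space_PiM PiE_def)
      have "ennreal (trunc_density_vec m a b \<mu> \<sigma> y) = (\<Prod>j<m. ennreal (?d j (y j)))"
        unfolding trunc_density_vec_def by (rule prod_ennreal[symmetric]) (use d0 in auto)
      moreover have "(indicator (Pi\<^sub>E {..<m} A) y :: ennreal) = (\<Prod>j<m. indicator (A j) (y j))"
      proof (cases "y \<in> Pi\<^sub>E {..<m} A")
        case True
        then show ?thesis by (auto simp: indicator_def PiE_def Pi_def intro!: prod.neutral[symmetric])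
      next
        case False
        with y obtain j where "j < m" "y j \<notin> A j" by (auto simp: PiE_def Pi_def)
        then have "(\<Prod>j<m. indicator (A j) (y j) :: ennreal) = 0"
          by (intro prod_zero bexI[of _ j]) auto
        with False show ?thesis by simp
      qed
      ultimately show "ennreal (trunc_density_vec m a b \<mu> \<sigma> y) * indicator (Pi\<^sub>E {..<m} A) y =
          (\<Prod>j<m. ennreal (?d j (y j)) * indicator (A j) (y j))"
        by (simp add: prod.distrib)
    qed
    also have "\<dots> = (\<Prod>j<m. \<integral>\<^sup>+x. ennreal (?d j x) * indicator (A j) x \<partial>lborel)"
      unfolding leb_def
      by (rule product_sigma_finite.product_nn_integral_prod[OF L]) (use A' in auto)
    also have "\<dots> = (\<Prod>j<m. emeasure (T j) (A j))"
    proof (rule prod.cong[OF refl])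
      fix j assume "j \<in> {..<m}"
      then have j: "j < m" by simp
      have "emeasure (T j) (A j) = emeasure (density lborel (\<lambda>x. ennreal (?d j x))) (A j)"
        unfolding T_def using j by (simp add: density_trunc_normal_density assms)
      also have "\<dots> = (\<integral>\<^sup>+x. ennreal (?d j x) * indicator (A j) x \<partial>lborel)"
        by (rule emeasure_density) (use A'[OF j] in auto)
      finally show "(\<integral>\<^sup>+x. ennreal (?d j x) * indicator (A j) x \<partial>lborel) = emeasure (T j) (A j)"
        by simp
    qed
    finally show "emeasure (density (leb m) (\<lambda>y. ennreal (trunc_density_vec m a b \<mu> \<sigma> y)))
        (Pi\<^sub>E {..<m} A) = (\<Prod>j\<in>{..<m}. emeasure (T j) (A j))" .
  qed simp
  have 2: "uniform_measure (PiM {..<m} N) (box_vec m a b) = PiM {..<m} T"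
  proof (rule product_sigma_finite.PiM_eqI[OF T])
    show "sets (uniform_measure (PiM {..<m} N) (box_vec m a b)) = sets (PiM {..<m} T)"
      by (simp add: setsNT)
  next
    fix A assume A: "\<And>j. j \<in> {..<m} \<Longrightarrow> A j \<in> sets (T j)"
    have A': "A j \<in> sets borel" if "j < m" for j using A[of j] that by (simp add: setsT)
    have AN: "Pi\<^sub>E {..<m} A \<in> sets (PiM {..<m} N)"
      by (rule sets_PiM_I_finite) (use A' in \<open>auto simp: setsN\<close>)
    let ?z = "\<lambda>j. LINT t:{a j..b j}|lborel. normal_density (\<mu> j) (\<sigma> j) t"
    have z: "emeasure (N j) {a j..b j} = ennreal (?z j)" "0 < ?z j" if "j < m" for j
      using that assms by (auto simp: N_def emeasure_normal_law_Icc intro: normal_mass_pos)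
    have fin: "emeasure (N j) ({a j..b j} \<inter> A j) = ennreal (measure (N j) ({a j..b j} \<inter> A j))"
      if "j < m" for j
    proof -
      interpret prob_space "N j"
        using that assms by (simp add: N_def prob_space_normal_law)
      show ?thesis by (rule emeasure_eq_measure)
    qed
    have "emeasure (uniform_measure (PiM {..<m} N) (box_vec m a b)) (Pi\<^sub>E {..<m} A) =
        emeasure (PiM {..<m} N) (box_vec m a b \<inter> Pi\<^sub>E {..<m} A) /
        emeasure (PiM {..<m} N) (box_vec m a b)"
      by (rule emeasure_uniform_measure[OF box AN])
    also have "box_vec m a b \<inter> Pi\<^sub>E {..<m} A = (\<Pi>\<^sub>E j\<in>{..<m}. {a j..b j} \<inter> A j)"
      unfolding box_vec_def by (rule PiE_Int)
    also have "emeasure (PiM {..<m} N) \<dots> = (\<Prod>j<m. emeasure (N j) ({a j..b j} \<inter> A j))"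
      by (rule product_sigma_finite.emeasure_PiM[OF N]) (use A' in \<open>auto simp: setsN\<close>)
    also have "\<dots> = (\<Prod>j<m. ennreal (measure (N j) ({a j..b j} \<inter> A j)))"
      by (rule prod.cong) (auto simp: fin)
    also have "\<dots> = ennreal (\<Prod>j<m. measure (N j) ({a j..b j} \<inter> A j))"
      by (rule prod_ennreal) auto
    also have "emeasure (PiM {..<m} N) (box_vec m a b) = (\<Prod>j<m. emeasure (N j) {a j..b j})"
      unfolding box_vec_def
      by (rule product_sigma_finite.emeasure_PiM[OF N]) (auto simp: setsN)
    also have "\<dots> = (\<Prod>j<m. ennreal (?z j))"
      by (rule prod.cong) (auto simp: z)
    also have "\<dots> = ennreal (\<Prod>j<m. ?z j)"
      by (rule prod_ennreal) (auto intro: less_imp_le z(2))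
    also have "ennreal (\<Prod>j<m. measure (N j) ({a j..b j} \<inter> A j)) / ennreal (\<Prod>j<m. ?z j) =
        ennreal (\<Prod>j<m. measure (N j) ({a j..b j} \<inter> A j) / ?z j)"
      by (subst divide_ennreal) (auto intro!: prod_nonneg prod_pos z(2) simp: prod_dividef)
    also have "\<dots> = (\<Prod>j<m. ennreal (measure (N j) ({a j..b j} \<inter> A j) / ?z j))"
      by (rule prod_ennreal[symmetric]) (auto intro!: divide_nonneg_pos z(2))
    also have "\<dots> = (\<Prod>j<m. emeasure (T j) (A j))"
    proof (rule prod.cong[OF refl])
      fix j assume "j \<in> {..<m}"
      then have j: "j < m" by simp
      have "emeasure (T j) (A j) = emeasure (N j) ({a j..b j} \<inter> A j) / emeasure (N j) {a j..b j}"
        using j A'[OF j] unfolding T_def N_def trunc_normal_law_def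
        by (simp add: emeasure_uniform_measure normal_law_def)
      also have "\<dots> = ennreal (measure (N j) ({a j..b j} \<inter> A j) / ?z j)"
        by (simp only: fin[OF j] z(1)[OF j]) (rule divide_ennreal; use z(2)[OF j] in simp)
      finally show "ennreal (measure (N j) ({a j..b j} \<inter> A j) / ?z j) = emeasure (T j) (A j)"
        by simp
    qed
    finally show "emeasure (uniform_measure (PiM {..<m} N) (box_vec m a b)) (Pi\<^sub>E {..<m} A) =
        (\<Prod>j\<in>{..<m}. emeasure (T j) (A j))" .
  qed simp
  show ?thesis unfolding PN 1 2 ..
qed

end

theory Submission
  imports Defs
begin

text \<open>
  Write \<open>undom m r A c\<close> for the volume of the part of the box \<open>[c, r]\<close> that \<open>A\<close> does not dominate, so
  that \<open>I\<^sub>A(y)\<close> is \<open>undom m r A y\<close>. Since \<open>[c, r] \<inter> [x, r] = [max c x, r]\<close>, adding a point \<open>x\<close> to \<open>A\<close>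
  changes this volume by the recursion
  \<open>undom r (A \<union> {x}) c = undom r A c - undom r A (max c x)\<close> (lemma \<open>undom_insert\<close>), and for \<open>A = {}\<close>
  it is the product of the side lengths \<open>(r\<^sub>j - c\<^sub>j)\<^sub>+\<close>.

  Representation. The claim \<open>E[undom r A (max Y c)] = undom \<psi>(r) \<psi>(A) \<psi>(c)\<close> is proved for
  all \<open>c\<close> by induction on \<open>A\<close> (lemma \<open>undom_expectation\<close>). For \<open>A = {}\<close> the independence of the
  coordinates reduces it to one dimension, where it rests on the pointwise identity
  \<open>(r - max y c)\<^sub>+ = (r - y)\<^sub>+ - (c - y)\<^sub>+\<close> for \<open>c \<le> r\<close>. The induction step is the recursion above on
  both sides, because the nondecreasing maps \<open>\<psi>\<^sub>j\<close> commute with \<open>max\<close>. The choice \<open>c = a\<close> gives the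
  theorem: \<open>max Y a = Y\<close> on the truncation box, and \<open>\<psi>(a) = 0\<close>.

  Mean monotonicity. By Tonelli's theorem the expected improvement is the integral, over the points
  \<open>z \<le> r\<close> not dominated by \<open>A\<close>, of \<open>P(Y \<le> z)\<close>, a product of one-dimensional distribution functions
  (lemma \<open>TEHVI_nn_integral_cdf\<close>). Each of them decreases in the mean, because the ratio of two normal
  densities with the same variance is monotone and truncation to a fixed interval only rescales
  this ratio.

  Variance monotonicity fails already for \<open>A = {}\<close>, \<open>[a, b] = [0, 1]\<^sup>2\<close>, \<open>\<mu> = 0\<close> and \<open>r = (1, 1)\<close>. There
  the expected improvement is \<open>E[1 - Y\<^sub>1] E[1 - Y\<^sub>2]\<close>. The untruncated mean sits at the left, best,
  end of the box, so spreading the law out can only move its mass to the right.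
\<close>

section \<open>Undominated volume\<close>

definition undom :: "nat \<Rightarrow> (nat \<Rightarrow> real) \<Rightarrow> (nat \<Rightarrow> real) set \<Rightarrow> (nat \<Rightarrow> real) \<Rightarrow> real"
  where "undom m r A c = measure (leb m) (box_vec m c r - Dom m r A)"

lemma product_sigma_finite_lborel: "product_sigma_finite (\<lambda>j::nat. lborel :: real measure)"
  by standard

lemma box_vec_cong: "(\<And>j. j < m \<Longrightarrow> c j = d j) \<Longrightarrow> box_vec m c r = box_vec m d r"
  unfolding box_vec_def by (intro PiE_cong) auto

lemma undom_cong: "(\<And>j. j < m \<Longrightarrow> c j = d j) \<Longrightarrow> undom m r A c = undom m r A d"
  unfolding undom_def by (simp cong: box_vec_cong)

lemma box_vec_Int: "box_vec m c r \<inter> box_vec m d r = box_vec m (\<lambda>j. max (c j) (d j)) r"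
  unfolding box_vec_def PiE_Int by (intro PiE_cong) auto

lemma emeasure_box_vec: "emeasure (leb m) (box_vec m c r) = ennreal (\<Prod>j<m. max (r j - c j) 0)"
proof -
  have "emeasure (leb m) (box_vec m c r) = (\<Prod>j<m. emeasure lborel {c j..r j})"
    unfolding leb_def box_vec_def
    by (rule product_sigma_finite.emeasure_PiM[OF product_sigma_finite_lborel]) auto
  also have "\<dots> = (\<Prod>j<m. ennreal (max (r j - c j) 0))"
    by (intro prod.cong) (auto simp: emeasure_lborel_Icc_eq max_def)
  also have "\<dots> = ennreal (\<Prod>j<m. max (r j - c j) 0)"
    by (rule prod_ennreal) auto
  finally show ?thesis .
qed

lemma box_vec_fmeasurable: "box_vec m c r \<in> fmeasurable (leb m)"
proof (rule fmeasurableI)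
  show "box_vec m c r \<in> sets (leb m)"
    unfolding leb_def box_vec_def by (rule sets_PiM_I_finite) auto
qed (simp add: emeasure_box_vec)

lemma Dom_fmeasurable: "finite A \<Longrightarrow> Dom m r A \<in> fmeasurable (leb m)"
  unfolding Dom_def by (intro fmeasurable.finite_UN) (auto simp: box_vec_fmeasurable)

lemma HV_eq_measure:
  assumes "finite A"
  shows "HV m r A = measure (leb m) (Dom m r A)"
proof -
  have "Dom m r A \<subseteq> space (leb m)"
    using fmeasurableD[OF Dom_fmeasurable[OF assms]] by (rule sets.sets_into_space)
  then show ?thesis
    by (simp add: HV_def set_lebesgue_integral_def Int_absorb2)
qed

lemma HVI_eq_undom:
  assumes "finite A"
  shows "HVI m r A y = undom m r A y"
proof -
  have "Dom m r (A \<union> {y}) = Dom m r A \<union> (box_vec m y r - Dom m r A)"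
    by (auto simp: Dom_def)
  moreover have "measure (leb m) (Dom m r A \<union> (box_vec m y r - Dom m r A)) =
      measure (leb m) (Dom m r A) + measure (leb m) (box_vec m y r - Dom m r A)"
    using Dom_fmeasurable[OF assms, of m r] box_vec_fmeasurable[of m y r]
    by (intro measure_Un_AE) (auto simp: fmeasurable_Diff fmeasurableD)
  ultimately show ?thesis
    using assms by (simp add: HVI_def HV_eq_measure undom_def)
qed

lemma undom_empty: "undom m r {} c = (\<Prod>j<m. max (r j - c j) 0)"
  by (simp add: undom_def Dom_def measure_def emeasure_box_vec prod_nonneg)

text \<open>
  The point \<open>x\<close> removes \<open>[c, r] \<inter> [x, r]\<close>, of which the part dominated by \<open>A\<close> is already missing.
\<close>

lemma undom_insert:
  assumes "finite A"
  shows "undom m r (insert x A) c = undom m r A c - undom m r A (\<lambda>j. max (c j) (x j))"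
proof -
  let ?B = "box_vec m c r - Dom m r A" and ?C = "box_vec m (\<lambda>j. max (c j) (x j)) r - Dom m r A"
  have "box_vec m c r - Dom m r (insert x A) = ?B - ?C"
    unfolding box_vec_Int[symmetric] by (auto simp: Dom_def)
  moreover have "measure (leb m) (?B - ?C) = measure (leb m) ?B - measure (leb m) ?C"
    using Dom_fmeasurable[OF assms, of m r] box_vec_fmeasurable[of m _ r]
    by (intro measurable_measure_Diff fmeasurable_Diff)
      (auto simp: fmeasurableD fmeasurable_Diff box_vec_Int[symmetric])
  ultimately show ?thesis
    by (simp add: undom_def)
qed

section \<open>Truncated normal laws\<close>

lemma trunc_normal_density_measurable [measurable]:
  "trunc_normal_density l u \<mu> s \<in> borel_measurable borel"
  unfolding trunc_normal_density_def by measurable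

lemma trunc_normal_density_nonneg:
  assumes "0 < s" "l < u"
  shows "0 \<le> trunc_normal_density l u \<mu> s x"
  using normal_mass_pos[OF assms, of \<mu>] by (auto simp: trunc_normal_density_def)

lemma sets_trunc_normal_law [measurable_cong, simp]: "sets (trunc_normal_law l u \<mu> s) = sets borel"
  by (simp add: trunc_normal_law_def normal_law_def)

lemma trunc_normal_law_integral:
  fixes h :: "real \<Rightarrow> real"
  assumes "0 < s" "l < u" and [measurable]: "h \<in> borel_measurable borel"
  shows "(LINT x|trunc_normal_law l u \<mu> s. h x) =
    (LINT x|lborel. trunc_normal_density l u \<mu> s x * h x)"
  unfolding density_trunc_normal_density[OF assms(1,2), symmetric]
  by (subst integral_real_density) (auto simp: trunc_normal_density_nonneg assms)

lemma trunc_normal_law_integrable_iff: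
  fixes h :: "real \<Rightarrow> real"
  assumes "0 < s" "l < u" and [measurable]: "h \<in> borel_measurable borel"
  shows "integrable (trunc_normal_law l u \<mu> s) h \<longleftrightarrow>
    integrable lborel (\<lambda>x. trunc_normal_density l u \<mu> s x * h x)"
  unfolding density_trunc_normal_density[OF assms(1,2), symmetric]
  by (subst integrable_real_density) (auto simp: trunc_normal_density_nonneg assms)

lemma AE_trunc_normal_law:
  assumes "0 < s" "l < u"
  shows "AE x in trunc_normal_law l u \<mu> s. x \<in> {l..u}"
  unfolding trunc_normal_law_def
  by (rule AE_uniform_measureI) (auto simp: normal_law_def)

lemma trunc_normal_law_integrable:
  fixes h :: "real \<Rightarrow> real"
  assumes "0 < s" "l < u" and h[measurable]: "h \<in> borel_measurable borel"
    and B: "\<And>x. x \<in> {l..u} \<Longrightarrow> \<bar>h x\<bar> \<le> B"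
  shows "integrable (trunc_normal_law l u \<mu> s) h"
proof -
  interpret prob_space "trunc_normal_law l u \<mu> s"
    by (rule prob_space_trunc_normal_law[OF assms(1,2)])
  show ?thesis
  proof (rule integrable_const_bound)
    show "AE x in trunc_normal_law l u \<mu> s. norm (h x) \<le> B"
      using AE_trunc_normal_law[OF assms(1,2)] by eventually_elim (use B in auto)
  qed measurable
qed

lemma trunc_normal_law_integrable_cont:
  fixes h :: "real \<Rightarrow> real"
  assumes "0 < s" "l < u" and h: "continuous_on UNIV h"
  shows "integrable (trunc_normal_law l u \<mu> s) h"
proof -
  have "compact (h ` {l..u})"
    by (intro compact_continuous_image continuous_on_subset[OF h]) auto
  then obtain B where "\<And>y. y \<in> h ` {l..u} \<Longrightarrow> norm y \<le> B"
    using compact_imp_bounded bounded_iff by metis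
  then show ?thesis
    using borel_measurable_continuous_onI[OF h]
    by (intro trunc_normal_law_integrable[OF assms(1,2), where B = B]) auto
qed

lemma psi1_mono:
  assumes "0 < s" "l < u" "c \<le> d"
  shows "psi1 l u \<mu> s c \<le> psi1 l u \<mu> s d"
  unfolding psi1_def
  by (intro integral_mono trunc_normal_law_integrable_cont assms continuous_intros)
    (use assms in auto)

text \<open>
  One-dimensional case of the representation. If \<open>c > r\<close>, both sides vanish, the right one because
  \<open>\<psi>\<close> is nondecreasing.
\<close>

lemma psi1_max_diff:
  assumes "0 < s" "l < u"
  shows "(LINT y|trunc_normal_law l u \<mu> s. max (r - max y c) 0) =
    max (psi1 l u \<mu> s r - psi1 l u \<mu> s c) 0"
proof -
  have i: "integrable (trunc_normal_law l u \<mu> s) (\<lambda>y. max (d - y) 0)" for d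
    by (intro trunc_normal_law_integrable_cont assms continuous_intros)
  note mono = psi1_mono[OF assms, where \<mu> = \<mu>]
  show ?thesis
  proof (cases "c \<le> r")
    case True
    then have "max (r - max y c) 0 = max (r - y) 0 - max (c - y) 0" for y
      by (auto simp: max_def)
    then have "(LINT y|trunc_normal_law l u \<mu> s. max (r - max y c) 0) =
        psi1 l u \<mu> s r - psi1 l u \<mu> s c"
      unfolding psi1_def by (simp add: i)
    with mono[OF True] show ?thesis by simp
  next
    case False
    then have "max (r - max y c) 0 = 0" for y
      by (auto simp: max_def)
    with mono[of r c] False show ?thesis by simp
  qed
qed

lemma psi1_max:
  assumes "0 < s" "l < u"
  shows "psi1 l u \<mu> s (max c d) = max (psi1 l u \<mu> s c) (psi1 l u \<mu> s d)"
  using psi1_mono[OF assms, of c d \<mu>] psi1_mono[OF assms, of d c \<mu>] by (auto simp: max_def)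

lemma psi1_lower:
  assumes "0 < s" "l < u"
  shows "psi1 l u \<mu> s l = 0"
proof -
  have "psi1 l u \<mu> s l = (LINT y|trunc_normal_law l u \<mu> s. 0)"
    unfolding psi1_def
    by (rule integral_cong_AE)
      (use AE_trunc_normal_law[OF assms, of \<mu>] in \<open>auto elim!: eventually_mono\<close>)
  then show ?thesis by simp
qed

section \<open>Expected undominated volume\<close>

text \<open>
  The lower corner \<open>c\<close> is a free parameter because the recursion for a new point \<open>x\<close> uses the
  induction hypothesis both at \<open>c\<close> and at \<open>max c x\<close>. Two points of \<open>A\<close> may have the same image under
  \<open>\<psi>\<close>, which is constant below \<open>a\<close>; the recursion remains valid then, since it does not
  ask the new point to lie outside the set.
\<close>

lemma undom_expectation:
  assumes ab: "\<forall>j<m. a j < b j" and s: "\<forall>j<m. 0 < \<sigma> j" and A: "finite A"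
  shows "integrable (leb m) (\<lambda>y. trunc_density_vec m a b \<mu> \<sigma> y * undom m r A (\<lambda>j. max (y j) (c j)))"
      (is "?I A c")
    and "(LINT y|leb m. trunc_density_vec m a b \<mu> \<sigma> y * undom m r A (\<lambda>j. max (y j) (c j))) =
      undom m (psi m a b \<mu> \<sigma> r) (psi m a b \<mu> \<sigma> ` A) (psi m a b \<mu> \<sigma> c)" (is "?E A c = ?R A c")
proof -
  let ?\<psi> = "psi m a b \<mu> \<sigma>"
  have "?I A c \<and> ?E A c = ?R A c"
    using A
  proof (induction A arbitrary: c rule: finite_induct)
    case empty
    let ?g = "\<lambda>j x. trunc_normal_density (a j) (b j) (\<mu> j) (\<sigma> j) x * max (r j - max x (c j)) 0"
    have eq: "trunc_density_vec m a b \<mu> \<sigma> y * undom m r {} (\<lambda>j. max (y j) (c j)) =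
        (\<Prod>j<m. ?g j (y j))" for y
      by (simp add: trunc_density_vec_def undom_empty prod.distrib)
    have gi: "integrable lborel (?g j)" if "j < m" for j
      by (subst trunc_normal_law_integrable_iff[symmetric])
        (use that ab s in \<open>auto intro!: trunc_normal_law_integrable_cont continuous_intros\<close>)
    have gv: "(LINT x|lborel. ?g j x) = max (?\<psi> r j - ?\<psi> c j) 0" if "j < m" for j
      using that ab s
      by (subst trunc_normal_law_integral[symmetric]) (auto simp: psi_def psi1_max_diff)
    have "integrable (leb m) (\<lambda>y. \<Prod>j<m. ?g j (y j))"
      unfolding leb_def
      by (rule product_sigma_finite.product_integrable_prod[OF product_sigma_finite_lborel])
        (auto simp: gi)
    moreover have "(LINT y|leb m. (\<Prod>j<m. ?g j (y j))) = (\<Prod>j<m. (LINT x|lborel. ?g j x))"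
      unfolding leb_def
      by (rule product_sigma_finite.product_integral_prod[OF product_sigma_finite_lborel])
        (auto simp: gi)
    ultimately show ?case
      unfolding image_empty undom_empty[of m "psi m a b \<mu> \<sigma> r"] eq by (simp add: gv)
  next
    case (insert x A)
    let ?cx = "\<lambda>j. max (c j) (x j)"
    have eq: "trunc_density_vec m a b \<mu> \<sigma> y * undom m r (insert x A) (\<lambda>j. max (y j) (c j)) =
        trunc_density_vec m a b \<mu> \<sigma> y * undom m r A (\<lambda>j. max (y j) (c j)) -
        trunc_density_vec m a b \<mu> \<sigma> y * undom m r A (\<lambda>j. max (y j) (?cx j))" for y
      using insert.hyps by (simp add: undom_insert right_diff_distrib max.assoc)
    have "?R (insert x A) c = ?R A c - ?R A ?cx"
      using insert.hyps ab s
      by (auto simp: undom_insert psi_def psi1_max intro!: undom_cong)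
    with insert.IH[of c] insert.IH[of ?cx] show ?case
      unfolding eq by simp
  qed
  then show "?I A c" "?E A c = ?R A c" by auto
qed

text \<open>
  The density vanishes outside the truncation box, and there it does not matter that \<open>max y a\<close> differs
  from \<open>y\<close>; so the general expectation formula applies with \<open>c = a\<close>.
\<close>

lemma TEHVI_expectation:
  assumes ab: "\<forall>j<m. a j < b j" and s: "\<forall>j<m. 0 < \<sigma> j" and A: "finite A"
  shows "integrable (leb m) (\<lambda>y. trunc_density_vec m a b \<mu> \<sigma> y * undom m r A y)"
    and "TEHVI m r A \<mu> \<sigma> a b = (LINT y|leb m. trunc_density_vec m a b \<mu> \<sigma> y * undom m r A y)"
    and "TEHVI m r A \<mu> \<sigma> a b =
      HV m (psi m a b \<mu> \<sigma> r) (psi m a b \<mu> \<sigma> ` A \<union> {zero_vec m})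
      - HV m (psi m a b \<mu> \<sigma> r) (psi m a b \<mu> \<sigma> ` A)"
proof -
  let ?d = "trunc_density_vec m a b \<mu> \<sigma>" and ?\<psi> = "psi m a b \<mu> \<sigma>"
  have d0: "?d y = 0" if "y \<in> space (leb m)" "y \<notin> box_vec m a b" for y
  proof -
    from that obtain j where "j < m" "y j \<notin> {a j..b j}"
      by (auto simp: leb_def space_PiM box_vec_def PiE_def Pi_def)
    then show ?thesis
      unfolding trunc_density_vec_def
      by (intro prod_zero bexI[of _ j]) (auto simp: trunc_normal_density_def)
  qed
  have eq: "?d y * undom m r A y = ?d y * undom m r A (\<lambda>j. max (y j) (a j))"
    if "y \<in> space (leb m)" for y
  proof (cases "y \<in> box_vec m a b")
    case True
    then have "undom m r A y = undom m r A (\<lambda>j. max (y j) (a j))"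
      by (intro undom_cong) (auto simp: box_vec_def PiE_def Pi_def max_def)
    then show ?thesis by simp
  qed (simp add: d0 that)
  show "integrable (leb m) (\<lambda>y. ?d y * undom m r A y)"
    using undom_expectation(1)[OF ab s A, where \<mu> = \<mu> and r = r and c = a]
    by (simp cong: Bochner_Integration.integrable_cong add: eq)
  show *: "TEHVI m r A \<mu> \<sigma> a b = (LINT y|leb m. ?d y * undom m r A y)"
    unfolding TEHVI_def set_lebesgue_integral_def
    by (rule Bochner_Integration.integral_cong)
      (auto simp: HVI_eq_undom[OF A] d0 indicator_def)
  also have "\<dots> = (LINT y|leb m. ?d y * undom m r A (\<lambda>j. max (y j) (a j)))"
    by (rule Bochner_Integration.integral_cong) (auto simp: eq)
  also have "\<dots> = undom m (?\<psi> r) (?\<psi> ` A) (?\<psi> a)"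
    by (rule undom_expectation(2)[OF ab s A])
  also have "\<dots> = undom m (?\<psi> r) (?\<psi> ` A) (zero_vec m)"
    by (rule undom_cong) (auto simp: psi_def zero_vec_def psi1_lower ab s)
  also have "\<dots> = HVI m (?\<psi> r) (?\<psi> ` A) (zero_vec m)"
    using A by (simp add: HVI_eq_undom)
  finally show "TEHVI m r A \<mu> \<sigma> a b = HV m (?\<psi> r) (?\<psi> ` A \<union> {zero_vec m}) - HV m (?\<psi> r) (?\<psi> ` A)"
    by (simp add: HVI_def)
qed

section \<open>Comparison of truncated normal laws by their likelihood ratio\<close>

definition normal_ratio :: "real \<Rightarrow> real \<Rightarrow> real \<Rightarrow> real \<Rightarrow> real \<Rightarrow> real"
  where "normal_ratio \<mu> s \<mu>' s' x = normal_density \<mu>' s' x / normal_density \<mu> s x"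

text \<open>
  Changing the parameters of the normal law reweights the truncated law by the likelihood ratio \<open>w\<close>,
  up to the quotient of the two normalizing constants, which is \<open>E[w]\<close>. In the form
  \<open>E'[h] E[w] = E[h w]\<close>, comparing \<open>E'[h]\<close> with \<open>E[h]\<close> amounts to finding the sign of
  \<open>E[(h - E[h]) w]\<close>. Continuity gives the integrability of \<open>w\<close>, which may be unbounded on the line
  but is bounded on \<open>{l..u}\<close>.
\<close>

lemma trunc_normal_tilt:
  fixes h :: "real \<Rightarrow> real" and \<mu> \<mu>' :: real
  assumes "0 < s" "0 < s'" "l < u" and h[measurable]: "h \<in> borel_measurable borel"
  defines "w \<equiv> normal_ratio \<mu> s \<mu>' s'"
  shows "(LINT x|trunc_normal_law l u \<mu>' s'. h x) * (LINT x|trunc_normal_law l u \<mu> s. w x) =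
    (LINT x|trunc_normal_law l u \<mu> s. h x * w x)"
    and "0 < (LINT x|trunc_normal_law l u \<mu> s. w x)"
    and "continuous_on UNIV w"
proof -
  let ?Z = "LINT t:{l..u}|lborel. normal_density \<mu> s t"
  let ?Z' = "LINT t:{l..u}|lborel. normal_density \<mu>' s' t"
  have Z: "0 < ?Z" "0 < ?Z'" using normal_mass_pos assms by auto
  have d: "normal_density \<mu> s x \<noteq> 0" for x
    using normal_density_pos[OF assms(1), of \<mu> x] by simp
  have [measurable]: "w \<in> borel_measurable borel"
    unfolding w_def normal_ratio_def[abs_def] by measurable
  have *: "(LINT x|trunc_normal_law l u \<mu> s. g x * w x) =
      (LINT x|trunc_normal_law l u \<mu>' s'. g x) * (?Z' / ?Z)"
    if [measurable]: "g \<in> borel_measurable borel" for g :: "real \<Rightarrow> real"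
  proof -
    have "(LINT x|trunc_normal_law l u \<mu> s. g x * w x) =
        (LINT x|lborel. (trunc_normal_density l u \<mu>' s' x * g x) * (?Z' / ?Z))"
      unfolding trunc_normal_law_integral[OF assms(1,3), of "\<lambda>x. g x * w x", simplified]
      by (rule Bochner_Integration.integral_cong[OF refl])
        (use Z d in \<open>simp add: trunc_normal_density_def w_def normal_ratio_def field_simps\<close>)
    also have "\<dots> = (LINT x|trunc_normal_law l u \<mu>' s'. g x) * (?Z' / ?Z)"
      by (simp only: integral_mult_left_zero trunc_normal_law_integral[OF assms(2,3) that])
    finally show ?thesis .
  qed
  interpret T': prob_space "trunc_normal_law l u \<mu>' s'"
    by (rule prob_space_trunc_normal_law[OF assms(2,3)])
  have w: "(LINT x|trunc_normal_law l u \<mu> s. w x) = ?Z' / ?Z"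
    using *[of "\<lambda>_. 1"] T'.prob_space by simp
  show "(LINT x|trunc_normal_law l u \<mu>' s'. h x) * (LINT x|trunc_normal_law l u \<mu> s. w x) =
      (LINT x|trunc_normal_law l u \<mu> s. h x * w x)"
    unfolding w by (simp add: *)
  show "0 < (LINT x|trunc_normal_law l u \<mu> s. w x)"
    unfolding w using Z by simp
  show "continuous_on UNIV w"
    unfolding w_def normal_ratio_def[abs_def] normal_density_def
    using assms by (intro continuous_intros) auto
qed

lemma normal_ratio_eq:
  assumes "0 < s" "0 < s'"
  shows "normal_ratio \<mu> s \<mu>' s' x = s / s' * exp ((x - \<mu>)\<^sup>2 / (2 * s\<^sup>2) - (x - \<mu>')\<^sup>2 / (2 * s'\<^sup>2))"
proof -
  have "exp (- (x - \<mu>')\<^sup>2 / (2 * s'\<^sup>2)) / exp (- (x - \<mu>)\<^sup>2 / (2 * s\<^sup>2)) =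
      exp ((x - \<mu>)\<^sup>2 / (2 * s\<^sup>2) - (x - \<mu>')\<^sup>2 / (2 * s'\<^sup>2))"
    by (simp add: exp_diff[symmetric])
  then show ?thesis
    using assms by (simp add: normal_ratio_def normal_density_def real_sqrt_mult field_simps)
qed

text \<open>
  With \<open>h\<close> the indicator of \<open>{..z}\<close> and \<open>p = E[h]\<close>, the factors \<open>h - p\<close> and \<open>w - w z\<close> are both
  nonnegative up to \<open>z\<close> and both nonpositive beyond it, because the likelihood ratio of the smaller
  mean to the larger one is nonincreasing.
  As \<open>h - p\<close> has mean zero, \<open>E[(h - p) w] = E[(h - p) (w - w z)] \<ge> 0\<close>.
\<close>

lemma emeasure_trunc_normal_atMost_antimono:
  assumes "0 < s" "l < u" "\<mu>' \<le> \<mu>"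
  shows "emeasure (trunc_normal_law l u \<mu> s) {..z} \<le> emeasure (trunc_normal_law l u \<mu>' s) {..z}"
proof -
  let ?T = "trunc_normal_law l u \<mu> s" and ?T' = "trunc_normal_law l u \<mu>' s"
  let ?w = "normal_ratio \<mu> s \<mu>' s" and ?h = "indicat_real {..z}"
  interpret T: prob_space ?T by (rule prob_space_trunc_normal_law[OF assms(1,2)])
  interpret T': prob_space ?T' by (rule prob_space_trunc_normal_law[OF assms(1,2)])
  let ?p = "measure ?T {..z}"
  have hm: "?h \<in> borel_measurable borel" by measurable
  note tilt = trunc_normal_tilt[OF assms(1,1,2) hm, where \<mu> = \<mu> and \<mu>' = \<mu>']
  have anti: "?w y \<le> ?w x" if "x \<le> y" for x y
  proof -
    have "(y - \<mu>)\<^sup>2 - (y - \<mu>')\<^sup>2 \<le> (x - \<mu>)\<^sup>2 - (x - \<mu>')\<^sup>2"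
      using mult_nonneg_nonneg[of "\<mu> - \<mu>'" "y - x"] that assms(3)
      by (simp add: power2_eq_square algebra_simps)
    then show ?thesis
      using assms(1) by (simp add: normal_ratio_eq diff_divide_distrib[symmetric] divide_right_mono)
  qed
  have wi: "integrable ?T ?w"
    by (rule trunc_normal_law_integrable_cont[OF assms(1,2) tilt(3)])
  have hwi: "integrable ?T (\<lambda>x. ?h x * ?w x)"
    using integrable_mult_indicator[OF _ wi, of "{..z}"] by simp
  have hi: "integrable ?T ?h" by (simp add: T.emeasure_eq_measure)
  \<comment> \<open>Subtracting \<open>w z\<close> does not change the integral and makes its integrand nonnegative.\<close>
  have "0 \<le> (LINT x|?T. (?h x - ?p) * (?w x - ?w z))"
  proof (rule integral_nonneg_AE, rule AE_I2)
    fix x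
    show "0 \<le> (?h x - ?p) * (?w x - ?w z)"
      using anti[of x z] anti[of z x] T.prob_le_1[of "{..z}"] measure_nonneg[of ?T "{..z}"]
      by (cases "x \<le> z") (auto intro!: mult_nonneg_nonneg mult_nonneg_nonpos)
  qed
  also have "(LINT x|?T. (?h x - ?p) * (?w x - ?w z)) =
      (LINT x|?T. ?h x * ?w x - ?p * ?w x - ?w z * ?h x + ?p * ?w z)"
    by (simp add: algebra_simps)
  also have "\<dots> = (LINT x|?T. ?h x * ?w x) - ?p * (LINT x|?T. ?w x)"
    using wi hwi hi T.prob_space by simp
  also have "\<dots> = (measure ?T' {..z} - ?p) * (LINT x|?T. ?w x)"
    using tilt(1) by (simp add: algebra_simps)
  finally have "?p \<le> measure ?T' {..z}"
    using tilt(2) by (simp add: zero_le_mult_iff)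
  then show ?thesis
    by (simp add: T.emeasure_eq_measure T'.emeasure_eq_measure)
qed

section \<open>Mean monotonicity\<close>

lemma trunc_density_vec_measurable [measurable]:
  "trunc_density_vec m a b \<mu> \<sigma> \<in> borel_measurable (leb m)"
  unfolding trunc_density_vec_def[abs_def] leb_def by measurable

lemma trunc_density_vec_nonneg:
  assumes "\<forall>j<m. a j < b j" and "\<forall>j<m. 0 < \<sigma> j"
  shows "0 \<le> trunc_density_vec m a b \<mu> \<sigma> y"
  unfolding trunc_density_vec_def
  by (intro prod_nonneg) (use assms in \<open>auto intro!: trunc_normal_density_nonneg\<close>)

text \<open>
  A point \<open>z \<le> r\<close> outside \<open>Dom m r A\<close> contributes to the improvement by \<open>Y\<close> exactly when \<open>Y \<le> z\<close>.
  Nonnegative integrals are used so that the order of integration can be exchanged without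
  an integrability condition.
\<close>

lemma TEHVI_nn_integral_cdf:
  assumes ab: "\<forall>j<m. a j < b j" and s: "\<forall>j<m. 0 < \<sigma> j" and A: "finite A"
  shows "ennreal (TEHVI m r A \<mu> \<sigma> a b) =
    (\<integral>\<^sup>+z. indicator ((\<Pi>\<^sub>E j\<in>{..<m}. {..r j}) - Dom m r A) z *
       (\<Prod>j<m. emeasure (trunc_normal_law (a j) (b j) (\<mu> j) (\<sigma> j)) {..z j}) \<partial>leb m)"
proof -
  let ?d = "trunc_density_vec m a b \<mu> \<sigma>"
  let ?\<tau> = "\<lambda>j. trunc_normal_density (a j) (b j) (\<mu> j) (\<sigma> j)"
  let ?G = "(\<Pi>\<^sub>E j\<in>{..<m}. {..r j}) - Dom m r A"
  \<comment> \<open>The indicator of \<open>y \<le> z\<close>, written as a product over coordinates to match the product density.\<close>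
  let ?k = "\<lambda>y z. \<Prod>j<m. (if y j \<le> z j then 1 else 0 :: ennreal)"
  have d0: "0 \<le> ?d y" for y by (rule trunc_density_vec_nonneg[OF ab s])
  have "sigma_finite_measure (leb m)"
    unfolding leb_def by (rule product_sigma_finite.sigma_finite[OF product_sigma_finite_lborel]) simp
  then interpret P: pair_sigma_finite "leb m" "leb m"
    by (simp add: pair_sigma_finite_def)
  have [measurable]: "?G \<in> sets (leb m)"
  proof (rule sets.Diff)
    show "(\<Pi>\<^sub>E j\<in>{..<m}. {..r j}) \<in> sets (leb m)"
      unfolding leb_def by (rule sets_PiM_I_finite) auto
  qed (rule fmeasurableD[OF Dom_fmeasurable[OF A]])
  have km[measurable]: "(\<lambda>(y, z). ?k y z) \<in> borel_measurable (leb m \<Otimes>\<^sub>M leb m)"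
    unfolding leb_def by measurable
  have kernel: "ennreal (undom m r A y) = (\<integral>\<^sup>+z. indicator ?G z * ?k y z \<partial>leb m)" for y
  proof -
    have fm: "box_vec m y r - Dom m r A \<in> fmeasurable (leb m)"
      using Dom_fmeasurable[OF A] box_vec_fmeasurable by (auto intro: fmeasurable_Diff fmeasurableD)
    then have "ennreal (undom m r A y) = emeasure (leb m) (box_vec m y r - Dom m r A)"
      unfolding undom_def by (simp add: emeasure_eq_measure2 fmeasurableD2)
    also have "\<dots> = (\<integral>\<^sup>+z. indicator (box_vec m y r - Dom m r A) z \<partial>leb m)"
      using fmeasurableD[OF fm] by simp
    also have "\<dots> = (\<integral>\<^sup>+z. indicator ?G z * ?k y z \<partial>leb m)"
    proof (rule nn_integral_cong)
      fix z assume "z \<in> space (leb m)"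
      then have z: "z \<in> extensional {..<m}" by (simp add: leb_def space_PiM PiE_def)
      show "indicator (box_vec m y r - Dom m r A) z = indicator ?G z * ?k y z"
      proof (cases "\<forall>j<m. y j \<le> z j")
        case True
        with z have "z \<in> box_vec m y r \<longleftrightarrow> z \<in> (\<Pi>\<^sub>E j\<in>{..<m}. {..r j})"
          by (auto simp: box_vec_def PiE_def Pi_def)
        moreover have "?k y z = 1" using True by (intro prod.neutral) auto
        ultimately show ?thesis by (simp add: indicator_def)
      next
        case False
        then obtain j where j: "j < m" "\<not> y j \<le> z j" by blast
        have "?k y z = 0"
          by (rule prod_zero) (use j in \<open>auto intro!: bexI[of _ j]\<close>)
        moreover have "z \<notin> box_vec m y r"
          using j PiE_mem[of z "{..<m}" "\<lambda>j. {y j..r j}" j] unfolding box_vec_def by fastforce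
        ultimately show ?thesis by simp
      qed
    qed
    finally show ?thesis .
  qed
  have inner: "(\<integral>\<^sup>+y. ennreal (?d y) * ?k y z \<partial>leb m) =
      (\<Prod>j<m. emeasure (trunc_normal_law (a j) (b j) (\<mu> j) (\<sigma> j)) {..z j})" for z
  proof -
    have "ennreal (?d y) * ?k y z = (\<Prod>j<m. ennreal (?\<tau> j (y j)) * indicator {..z j} (y j))" for y
    proof -
      have "ennreal (?d y) = (\<Prod>j<m. ennreal (?\<tau> j (y j)))"
        unfolding trunc_density_vec_def
        by (rule prod_ennreal[symmetric]) (use ab s in \<open>auto intro!: trunc_normal_density_nonneg\<close>)
      moreover have "?k y z = (\<Prod>j<m. indicator {..z j} (y j))"
        by (intro prod.cong) (auto simp: indicator_def)
      ultimately show ?thesis by (simp only: prod.distrib)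
    qed
    then have "(\<integral>\<^sup>+y. ennreal (?d y) * ?k y z \<partial>leb m) =
        (\<integral>\<^sup>+y. (\<Prod>j<m. ennreal (?\<tau> j (y j)) * indicator {..z j} (y j)) \<partial>leb m)"
      by simp
    also have "\<dots> = (\<Prod>j<m. \<integral>\<^sup>+x. ennreal (?\<tau> j x) * indicator {..z j} x \<partial>lborel)"
      unfolding leb_def
      by (rule product_sigma_finite.product_nn_integral_prod[OF product_sigma_finite_lborel]) auto
    also have "\<dots> = (\<Prod>j<m. emeasure (trunc_normal_law (a j) (b j) (\<mu> j) (\<sigma> j)) {..z j})"
      using ab s by (intro prod.cong refl)
        (simp add: density_trunc_normal_density[symmetric] emeasure_density)
    finally show ?thesis .
  qed
  have "ennreal (TEHVI m r A \<mu> \<sigma> a b) = (\<integral>\<^sup>+y. ennreal (?d y * undom m r A y) \<partial>leb m)"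
    unfolding TEHVI_expectation(2)[OF ab s A]
    by (rule nn_integral_eq_integral[symmetric, OF TEHVI_expectation(1)[OF ab s A]])
      (auto simp: d0 undom_def)
  also have "\<dots> = (\<integral>\<^sup>+y. \<integral>\<^sup>+z. ennreal (?d y) * (indicator ?G z * ?k y z) \<partial>leb m \<partial>leb m)"
  proof (rule nn_integral_cong)
    fix y assume y: "y \<in> space (leb m)"
    have [measurable]: "?k y \<in> borel_measurable (leb m)"
      using measurable_compose[OF measurable_Pair1'[OF y] km] by simp
    show "ennreal (?d y * undom m r A y) = (\<integral>\<^sup>+z. ennreal (?d y) * (indicator ?G z * ?k y z) \<partial>leb m)"
      by (simp add: ennreal_mult' d0 kernel nn_integral_cmult)
  qed
  also have "\<dots> = (\<integral>\<^sup>+z. \<integral>\<^sup>+y. ennreal (?d y) * (indicator ?G z * ?k y z) \<partial>leb m \<partial>leb m)"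
    by (rule P.Fubini'[symmetric]) (use km in \<open>simp add: case_prod_unfold\<close>)
  also have "\<dots> = (\<integral>\<^sup>+z. indicator ?G z * (\<integral>\<^sup>+y. ennreal (?d y) * ?k y z \<partial>leb m) \<partial>leb m)"
  proof (rule nn_integral_cong)
    fix z assume z: "z \<in> space (leb m)"
    have [measurable]: "(\<lambda>y. ?k y z) \<in> borel_measurable (leb m)"
      using measurable_compose[OF measurable_Pair2'[OF z] km] by simp
    show "(\<integral>\<^sup>+y. ennreal (?d y) * (indicator ?G z * ?k y z) \<partial>leb m) =
        indicator ?G z * (\<integral>\<^sup>+y. ennreal (?d y) * ?k y z \<partial>leb m)"
      by (subst nn_integral_cmult[symmetric]) (auto simp: ac_simps)
  qed
  finally show ?thesis by (simp only: inner)
qed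

lemma TEHVI_antimono_mean:
  assumes ab: "\<forall>j<m. a j < b j" and s: "\<forall>j<m. 0 < \<sigma> j" and A: "finite A"
    and \<mu>: "\<forall>j<m. \<mu>' j \<le> \<mu> j"
  shows "TEHVI m r A \<mu> \<sigma> a b \<le> TEHVI m r A \<mu>' \<sigma> a b"
proof -
  have "0 \<le> TEHVI m r A \<mu>' \<sigma> a b"
    unfolding TEHVI_expectation(2)[OF ab s A]
    by (intro Bochner_Integration.integral_nonneg) (auto simp: trunc_density_vec_nonneg[OF ab s] undom_def)
  moreover have "ennreal (TEHVI m r A \<mu> \<sigma> a b) \<le> ennreal (TEHVI m r A \<mu>' \<sigma> a b)"
    unfolding TEHVI_nn_integral_cdf[OF ab s A]
    by (intro nn_integral_mono mult_left_mono prod_mono_ennreal)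
      (auto intro!: emeasure_trunc_normal_atMost_antimono simp: ab s \<mu>)
  ultimately show ?thesis by (simp add: ennreal_le_iff)
qed

section \<open>Failure of variance monotonicity\<close>

text \<open>
  Here the likelihood ratio \<open>w\<close> of the larger to the smaller standard deviation increases strictly
  on \<open>{0..1}\<close>, whereas \<open>h x = 1 - x\<close> decreases. With \<open>q = 1 - E[h]\<close>, the mean of the law, the factors
  \<open>h x - E[h] = q - x\<close> and \<open>w x - w q\<close> have opposite signs for \<open>x \<noteq> q\<close>, so that
  \<open>E[(h - E[h]) w] < 0\<close>.
\<close>

lemma psi1_strict_antimono_sd:
  assumes "0 < s" "s < s'"
  shows "psi1 0 1 0 s' 1 < psi1 0 1 0 s 1"
proof -
  let ?T = "trunc_normal_law 0 1 0 s" and ?T' = "trunc_normal_law 0 1 0 s'"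
  let ?w = "normal_ratio 0 s 0 s'" and ?h = "\<lambda>x::real. max (1 - x) 0"
  have s': "0 < s'" using assms by simp
  interpret T: prob_space ?T by (rule prob_space_trunc_normal_law) (use assms in auto)
  define q where "q = 1 - psi1 0 1 0 s 1"
  have hm: "?h \<in> borel_measurable borel" by measurable
  have hc: "continuous_on UNIV ?h" by (intro continuous_intros)
  note tilt = trunc_normal_tilt[OF assms(1) s' zero_less_one hm, where \<mu> = 0 and \<mu>' = 0]
  note int = trunc_normal_law_integrable_cont[OF assms(1) zero_less_one, of _ 0]
  have AE01: "AE x in ?T. x \<in> {0..1}"
    by (rule AE_trunc_normal_law) (use assms in auto)
  have strict: "?w x < ?w y" if "0 \<le> x" "x < y" for x y
  proof -
    let ?c = "1 / (2 * s\<^sup>2) - 1 / (2 * s'\<^sup>2)"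
    have "s\<^sup>2 < s'\<^sup>2" using assms by (intro power_strict_mono) auto
    then have "0 < ?c" using assms by (simp add: field_simps)
    moreover have "x\<^sup>2 < y\<^sup>2" using that by (intro power_strict_mono) auto
    ultimately have "x\<^sup>2 * ?c < y\<^sup>2 * ?c" by (rule mult_strict_right_mono[rotated])
    moreover have "t\<^sup>2 / (2 * s\<^sup>2) - t\<^sup>2 / (2 * s'\<^sup>2) = t\<^sup>2 * ?c" for t
      by (simp add: algebra_simps)
    ultimately have "exp (x\<^sup>2 / (2 * s\<^sup>2) - x\<^sup>2 / (2 * s'\<^sup>2)) < exp (y\<^sup>2 / (2 * s\<^sup>2) - y\<^sup>2 / (2 * s'\<^sup>2))"
      by simp
    then have "s / s' * exp (x\<^sup>2 / (2 * s\<^sup>2) - x\<^sup>2 / (2 * s'\<^sup>2)) <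
        s / s' * exp (y\<^sup>2 / (2 * s\<^sup>2) - y\<^sup>2 / (2 * s'\<^sup>2))"
      by (rule mult_strict_left_mono) (use assms s' in simp)
    then show ?thesis
      unfolding normal_ratio_eq[OF assms(1) s'] by simp
  qed
  have hi: "integrable ?T ?h" and wi: "integrable ?T ?w" and hwi: "integrable ?T (\<lambda>x. ?h x * ?w x)"
    by (intro int hc tilt(3) continuous_on_mult)+
  \<comment> \<open>The ratio decreases on the negative axis, so \<open>q\<close> has to be located in the region of increase.\<close>
  have "psi1 0 1 0 s 1 \<le> (LINT x|?T. 1)"
    unfolding psi1_def by (rule integral_mono_AE[OF hi]) (use AE01 in auto)
  then have q: "0 \<le> q" by (simp add: q_def T.prob_space)
  let ?f = "\<lambda>x. (q - (1 - ?h x)) * (?w x - ?w q)"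
  have fi: "integrable ?T ?f"
    by (intro int continuous_on_mult continuous_on_diff continuous_on_const hc tilt(3))
  have f: "?f x < 0" if "x \<in> {0..1}" "x \<noteq> q" for x
    using that q strict[of x q] strict[of q x]
    by (cases "x < q") (auto intro: mult_pos_neg mult_neg_pos)
  have ne: "AE x in ?T. x \<noteq> q"
    unfolding density_trunc_normal_density[OF assms(1) zero_less_one, symmetric]
    by (subst AE_density) (use AE_lborel_singleton[of q] in \<open>auto elim: eventually_mono\<close>)
  have "(LINT x|?T. ?f x) < (LINT x|?T. 0)"
  proof (rule T.integral_less_AE_space[OF fi])
    show "AE x in ?T. ?f x < 0" using AE01 ne by eventually_elim (rule f)
    show "emeasure ?T (space ?T) \<noteq> 0" by (simp add: T.emeasure_space_1)
  qed simp
  also have "(LINT x|?T. ?f x) =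
      (LINT x|?T. ?h x * ?w x - (1 - q) * ?w x - ?w q * ?h x + (1 - q) * ?w q)"
    by (simp add: algebra_simps)
  also have "\<dots> = (LINT x|?T. ?h x * ?w x) - (1 - q) * (LINT x|?T. ?w x)"
    using wi hwi hi T.prob_space by (simp add: q_def psi1_def)
  also have "\<dots> = (psi1 0 1 0 s' 1 - psi1 0 1 0 s 1) * (LINT x|?T. ?w x)"
    unfolding tilt(1)[symmetric] by (simp add: algebra_simps q_def psi1_def)
  finally show ?thesis
    using tilt(2) by (simp add: mult_less_0_iff)
qed

text \<open>
  Nothing is dominated beforehand, so the whole box \<open>[Y, r]\<close> is gained, and its expected volume factorizes.
\<close>

lemma TEHVI_empty:
  assumes ab: "\<forall>j<m. a j < b j" and s: "\<forall>j<m. 0 < \<sigma> j"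
  shows "TEHVI m r {} \<mu> \<sigma> a b = (\<Prod>j<m. psi1 (a j) (b j) (\<mu> j) (\<sigma> j) (r j))"
proof -
  have "0 \<le> psi1 l u \<nu> t c" for l u \<nu> t c
    unfolding psi1_def by (intro Bochner_Integration.integral_nonneg) auto
  then have "undom m (psi m a b \<mu> \<sigma> r) {} (zero_vec m) = (\<Prod>j<m. psi1 (a j) (b j) (\<mu> j) (\<sigma> j) (r j))"
    unfolding undom_empty by (intro prod.cong) (auto simp: psi_def zero_vec_def)
  then show ?thesis
    unfolding TEHVI_expectation(3)[OF ab s finite.emptyI] image_empty HVI_def[symmetric]
    by (simp add: HVI_eq_undom)
qed

lemma TEHVI_variance_counterexample:
  "\<exists>m\<ge>2. \<exists>A r a b \<mu> \<sigma> \<sigma>'. finite A \<and> A \<subseteq> Rvec m \<and>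
        r \<in> Rvec m \<and> a \<in> Rvec m \<and> b \<in> Rvec m \<and> \<mu> \<in> Rvec m \<and> \<sigma> \<in> Rvec m \<and> \<sigma>' \<in> Rvec m \<and>
        (\<forall>j<m. a j < b j) \<and> (\<forall>j<m. 0 < \<sigma> j) \<and> (\<forall>j<m. 0 < \<sigma>' j) \<and> (\<forall>j<m. \<sigma> j \<le> \<sigma>' j) \<and>
        TEHVI m r A \<mu> \<sigma>' a b < TEHVI m r A \<mu> \<sigma> a b"
proof -
  let ?v = "\<lambda>c::real. \<lambda>j\<in>{..<2::nat}. c"
  have v: "?v c \<in> Rvec 2" for c by (simp add: Rvec_def)
  have T: "TEHVI 2 (?v 1) {} (?v 0) (?v s) (?v 0) (?v 1) = (psi1 0 1 0 s 1)\<^sup>2" if "0 < s" for s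
    by (subst TEHVI_empty) (use that in \<open>auto simp: numeral_2_eq_2\<close>)
  have "psi1 0 1 0 2 1 < psi1 0 1 0 1 1" by (rule psi1_strict_antimono_sd) auto
  moreover have "0 \<le> psi1 0 1 0 2 1"
    unfolding psi1_def by (intro Bochner_Integration.integral_nonneg) auto
  ultimately have "TEHVI 2 (?v 1) {} (?v 0) (?v 2) (?v 0) (?v 1) <
      TEHVI 2 (?v 1) {} (?v 0) (?v 1) (?v 0) (?v 1)"
    by (simp only: T zero_less_numeral zero_less_one) (rule power_strict_mono; simp)
  then show ?thesis
    by (intro exI[of _ 2] conjI exI[of _ "{}"] exI[of _ "?v 1"] exI[of _ "?v 0"] exI[of _ "?v 2"])
      (auto simp: v)
qed

theorem proposition4p4:
  shows
    "(\<forall>m A r a b. finite A \<and> A \<subseteq> Rvec m \<and> r \<in> Rvec m \<and> a \<in> Rvec m \<and> b \<in> Rvec m \<and>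
        (\<forall>j<m. a j < b j) \<longrightarrow>
        (\<forall>\<mu>\<in>Rvec m. \<forall>\<sigma>\<in>Rvec m. (\<forall>j<m. 0 < \<sigma> j) \<longrightarrow>
          TEHVI m r A \<mu> \<sigma> a b =
            HV m (psi m a b \<mu> \<sigma> r) (psi m a b \<mu> \<sigma> ` A \<union> {zero_vec m})
            - HV m (psi m a b \<mu> \<sigma> r) (psi m a b \<mu> \<sigma> ` A)) \<and>
        (\<forall>\<mu>\<in>Rvec m. \<forall>\<mu>'\<in>Rvec m. \<forall>\<sigma>\<in>Rvec m. (\<forall>j<m. 0 < \<sigma> j) \<and> (\<forall>j<m. \<mu>' j \<le> \<mu> j) \<longrightarrow>
          TEHVI m r A \<mu>' \<sigma> a b \<ge> TEHVI m r A \<mu> \<sigma> a b)) \<and>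
     (\<exists>m\<ge>2. \<exists>A r a b \<mu> \<sigma> \<sigma>'. finite A \<and> A \<subseteq> Rvec m \<and>
        r \<in> Rvec m \<and> a \<in> Rvec m \<and> b \<in> Rvec m \<and> \<mu> \<in> Rvec m \<and> \<sigma> \<in> Rvec m \<and> \<sigma>' \<in> Rvec m \<and>
        (\<forall>j<m. a j < b j) \<and> (\<forall>j<m. 0 < \<sigma> j) \<and> (\<forall>j<m. 0 < \<sigma>' j) \<and> (\<forall>j<m. \<sigma> j \<le> \<sigma>' j) \<and>
        TEHVI m r A \<mu> \<sigma>' a b < TEHVI m r A \<mu> \<sigma> a b)"
proof (intro conjI allI impI ballI)
  show "TEHVI m r A \<mu> \<sigma> a b =
      HV m (psi m a b \<mu> \<sigma> r) (psi m a b \<mu> \<sigma> ` A \<union> {zero_vec m})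
      - HV m (psi m a b \<mu> \<sigma> r) (psi m a b \<mu> \<sigma> ` A)"
    if "finite A \<and> A \<subseteq> Rvec m \<and> r \<in> Rvec m \<and> a \<in> Rvec m \<and> b \<in> Rvec m \<and> (\<forall>j<m. a j < b j)"
      and "\<forall>j<m. 0 < \<sigma> j" for m A r a b \<mu> \<sigma>
    by (rule TEHVI_expectation(3)) (use that in blast)+
  show "TEHVI m r A \<mu>' \<sigma> a b \<ge> TEHVI m r A \<mu> \<sigma> a b"
    if "finite A \<and> A \<subseteq> Rvec m \<and> r \<in> Rvec m \<and> a \<in> Rvec m \<and> b \<in> Rvec m \<and> (\<forall>j<m. a j < b j)"
      and "(\<forall>j<m. 0 < \<sigma> j) \<and> (\<forall>j<m. \<mu>' j \<le> \<mu> j)" for m A r a b \<mu> \<mu>' \<sigma>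
    by (rule TEHVI_antimono_mean) (use that in blast)+
qed (rule TEHVI_variance_counterexample)

end
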